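(* The linear map $\phi:\mathcal{PT}_{\mathbb N^*}\to\mathcal{PT}_{\mathbb N^*}$ is a bijection.
   Context: $\mathbb K$ is a fixed field; $\mathbb N^*=\{1,2,3,\dots\}$. Planar rooted trees are finite rooted trees with linearly ordered children at every vertex. $\mathrm{PT}_{\mathbb N^*}$ is the set of non-empty planar rooted trees with vertices decorated by $\mathbb N^*$, $\mathcal{PT}_{\mathbb N^*}$ the $\mathbb K$-vector space with basis $\mathrm{PT}_{\mathbb N^*}$. $B_+^n(T_1\cdots T_k)$ grafts $T_1,\dots,T_k$ in this order on a new root decorated by $n$; $B_+^n(\emptyset)$ is the one-vertex tree. Forests are finite, possibly empty, ordered sequences of trees. A ladder tree is one in which every vertex has at most one child. A non-ladder tree $T\in\mathrm{PT}_{\mathbb N^*}$ is uniquely $T=B\big(B_+^{n_a}(F_a)B_+^{n_b}(F_b)F\big)$ with $B=B_+^{n_1}\circ\cdots\circ B_+^{n_p}$, $p\ge1$, and $F_a,F_b,F$ possibly empty forests. Set $T^a_b:=B(B_+^{n_a}(B_+^{n_b}(F_b)F_a)F)$, $T^b_a:=B(B_+^{n_b}(B_+^{n_a}(F_a)F_b)F)$, $T_{a+b}:=B(B_+^{n_a+n_b}(F_aF_b)F)$. The process tree $\mathrm{pr}(T)$, a planar rooted tree with vertices decorated by trees (decoration map $\delta_{\mathrm{pr}(T)}:V(\mathrm{pr}(T))\to\mathcal{PT}_{\mathbb N^*}$), is defined by the well-founded recursion: a single vertex decorated by $T$ if $T$ is a ladder tree; otherwise a root decorated by $T$ with children subtrees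 $\mathrm{pr}(T_{a+b}),\mathrm{pr}(T^a_b),\mathrm{pr}(T^b_a)$ in this order. The error term is $T^e=0$ if $T$ is a ladder tree and otherwise $$T^e=T_{a+b}-\sum_{i=1}^{n_a-1}\binom{n_a-i+n_b-1}{n_b-1}B\big(B_+^{n_a+n_b-i}(B_+^i(F_a)F_b)F\big)-\sum_{i=1}^{n_b-1}\binom{n_b-i+n_a-1}{n_a-1}B\big(B_+^{n_a+n_b-i}(B_+^i(F_b)F_a)F\big).$$ The map $\phi$ is the linear map defined on trees by $\phi(T)=T+\sum_{v\in V(\mathrm{pr}(T))}(\delta_{\mathrm{pr}(T)}(v))^e$. *)

theory Defs
  imports Complex_Main "HOL-Library.Poly_Mapping"
begin

section \<open>Decorated planar rooted trees\<close>

typedef pos = "{n :: nat. 1 \<le> n}" morphisms nat_of_pos pos_of_nat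
  by auto

datatype 'a ptree = Node (root_label: 'a) (children: "'a ptree list")

text \<open>
  Forests are lists of trees, and \<open>Node n F\<close> is \<open>B\<^sub>+\<close> of the forest \<open>F\<close> with new root
  decoration \<open>n\<close>. All trees of this datatype are non-empty.
\<close>

type_synonym PT = "pos ptree"

text \<open>
  The vertices of a tree are represented by their addresses: the root is \<open>[]\<close>, and \<open>i # p\<close> is
  the vertex with address \<open>p\<close> in the \<open>i\<close>-th child subtree, counting from 0.
\<close>

function vertices :: "'a ptree \<Rightarrow> nat list set" where
  "vertices (Node a ts) = insert [] (\<Union>i\<in>{..<length ts}. (#) i ` vertices (ts ! i))"
  by pat_completeness auto
termination
proof (relation "measure size", goal_cases)
  case 1
  show ?case by simp
next
  case (2 a ts i)
  then have "ts ! i \<in> set ts" by simp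
  then have "size (ts ! i) < Suc (size_list size ts)"
    by (meson less_SucI size_list_estimation' le_imp_less_Suc order_refl)
  then show ?case by simp
qed

lemma finite_vertices: "finite (vertices t)"
  by (induction t rule: vertices.induct) simp

primrec decoration :: "'a ptree \<Rightarrow> nat list \<Rightarrow> 'a" where
  "decoration (Node a ts) = (\<lambda>p. case p of [] \<Rightarrow> a | i # q \<Rightarrow> (map decoration ts ! i) q)"

lemma decoration_Nil [simp]: "decoration (Node a ts) [] = a"
  and decoration_Cons [simp]:
    "i < length ts \<Longrightarrow> decoration (Node a ts) (i # p) = decoration (ts ! i) p"
  by simp_all

primrec is_ladder :: "'a ptree \<Rightarrow> bool" where
  "is_ladder (Node a ts) \<longleftrightarrow> length ts \<le> 1 \<and> list_all is_ladder ts"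

section \<open>The decomposition of non-ladder trees\<close>

text \<open>
  \<open>trunk n [m\<^sub>2, \<dots>, m\<^sub>p]\<close> is the operator \<open>B\<close> given by the composition of the grafting operators
  for \<open>n, m\<^sub>2, \<dots>, m\<^sub>p\<close>; taking the first decoration separately enforces \<open>p \<ge> 1\<close>.
\<close>

primrec trunk :: "'a \<Rightarrow> 'a list \<Rightarrow> 'a ptree list \<Rightarrow> 'a ptree" where
  "trunk n [] F = Node n F"
| "trunk n (m # ms) F = Node n [trunk m ms F]"

type_synonym 'a decomposition =
  "('a ptree list \<Rightarrow> 'a ptree) \<times> 'a \<times> 'a ptree list \<times> 'a \<times> 'a ptree list \<times> 'a ptree list"

fun decompose :: "'a ptree \<Rightarrow> 'a decomposition option" where
  "decompose (Node n []) = None"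
| "decompose (Node n [t]) =
     map_option (\<lambda>(B, rest). (\<lambda>F. Node n [B F], rest)) (decompose t)"
| "decompose (Node n (Node na Fa # Node nb Fb # F)) = Some (Node n, na, Fa, nb, Fb, F)"

lemma decompose_eq_None_iff: "decompose T = None \<longleftrightarrow> is_ladder T"
  by (induction T rule: decompose.induct) auto

lemma decompose_trunk:
  "decompose (trunk n ns (Node na Fa # Node nb Fb # F)) = Some (trunk n ns, na, Fa, nb, Fb, F)"
  by (induction ns arbitrary: n) (auto simp: fun_eq_iff)

lemma decompose_SomeD:
  assumes "decompose T = Some (B, na, Fa, nb, Fb, F)"
  shows "T = B (Node na Fa # Node nb Fb # F) \<and> (\<exists>n ns. B = trunk n ns)"
  using assms
proof (induction T arbitrary: B rule: decompose.induct)
  case (2 n t)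
  then obtain B' where B': "decompose t = Some (B', na, Fa, nb, Fb, F)" "B = (\<lambda>F. Node n [B' F])"
    by auto
  from "2.IH"[OF B'(1)] obtain m ms
    where "t = B' (Node na Fa # Node nb Fb # F)" "B' = trunk m ms" by blast
  moreover from this(2) B'(2) have "B = trunk n (m # ms)" by (simp add: fun_eq_iff)
  ultimately show ?case using B'(2) by blast
next
  case (3 n na' Fa' nb' Fb' F')
  then have "B = trunk n []" by (auto simp: fun_eq_iff)
  moreover from 3 have "Node n (Node na' Fa' # Node nb' Fb' # F') = B (Node na Fa # Node nb Fb # F)"
    by auto
  ultimately show ?case by blast
qed simp

lemma decompose_eq_Some_iff:
  "decompose T = Some (B, na, Fa, nb, Fb, F) \<longleftrightarrow>
     (\<exists>n ns. B = trunk n ns) \<and> T = B (Node na Fa # Node nb Fb # F)"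
  using decompose_SomeD decompose_trunk by metis

text \<open>
  The trees \<open>T\<^sub>a\<^sub>+\<^sub>b\<close> (merging), \<open>T\<^sup>a\<^sub>b\<close> (\<open>b\<close> below \<open>a\<close>) and \<open>T\<^sup>b\<^sub>a\<close> (\<open>a\<close> below \<open>b\<close>), with the value \<open>T\<close>
  on ladder trees, where they are never used.
\<close>

definition tree_merge :: "PT \<Rightarrow> PT" where
  "tree_merge T = (case decompose T of None \<Rightarrow> T
     | Some (B, na, Fa, nb, Fb, F) \<Rightarrow>
         B (Node (pos_of_nat (nat_of_pos na + nat_of_pos nb)) (Fa @ Fb) # F))"

definition tree_ab :: "PT \<Rightarrow> PT" where
  "tree_ab T = (case decompose T of None \<Rightarrow> T
     | Some (B, na, Fa, nb, Fb, F) \<Rightarrow> B (Node na (Node nb Fb # Fa) # F))"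

definition tree_ba :: "PT \<Rightarrow> PT" where
  "tree_ba T = (case decompose T of None \<Rightarrow> T
     | Some (B, na, Fa, nb, Fb, F) \<Rightarrow> B (Node nb (Node na Fa # Fb) # F))"

section \<open>The process tree\<close>

text \<open>
  The recursion terminates because merging lowers the number of vertices, while the other two
  operations keep it and raise the sum of the sizes of all rooted subtrees.
\<close>

primrec num_vertices :: "'a ptree \<Rightarrow> nat" where
  "num_vertices (Node a ts) = 1 + sum_list (map num_vertices ts)"

primrec subtree_sizes :: "'a ptree \<Rightarrow> nat" where
  "subtree_sizes (Node a ts) =
     1 + sum_list (map num_vertices ts) + sum_list (map subtree_sizes ts)"

lemma num_vertices_pos: "0 < num_vertices t"
  by (cases t) simp

lemma sum_list_squares_le: "sum_list (map (\<lambda>x. (f x)\<^sup>2) xs) \<le> (sum_list (map f xs) :: nat)\<^sup>2"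
  by (induction xs) (auto simp: power2_eq_square algebra_simps)

lemma subtree_sizes_le: "subtree_sizes t \<le> (num_vertices t)\<^sup>2"
proof (induction t)
  case (Node a ts)
  let ?N = "sum_list (map num_vertices ts)"
  have "sum_list (map subtree_sizes ts) \<le> sum_list (map (\<lambda>t. (num_vertices t)\<^sup>2) ts)"
    using Node by (intro sum_list_mono) auto
  also have "\<dots> \<le> ?N\<^sup>2" by (rule sum_list_squares_le)
  finally have "subtree_sizes (Node a ts) \<le> 1 + ?N + ?N\<^sup>2" by simp
  also have "\<dots> \<le> (1 + ?N)\<^sup>2" by (simp add: power2_eq_square)
  finally show ?case by simp
qed

lemma num_vertices_trunk:
  "num_vertices (trunk n ns F) = 1 + length ns + sum_list (map num_vertices F)"
  by (induction ns arbitrary: n) auto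

lemma subtree_sizes_trunk_mono:
  assumes "sum_list (map num_vertices F) = sum_list (map num_vertices G)"
    and "sum_list (map subtree_sizes F) < sum_list (map subtree_sizes G)"
  shows "subtree_sizes (trunk n ns F) < subtree_sizes (trunk n ns G)"
  using assms by (induction ns arbitrary: n) (auto simp: num_vertices_trunk)

context
  fixes T :: PT
  assumes non_ladder: "\<not> is_ladder T"
begin

private lemma decomposition:
  obtains n ns na Fa nb Fb F where
    "decompose T = Some (trunk n ns, na, Fa, nb, Fb, F)"
    "T = trunk n ns (Node na Fa # Node nb Fb # F)"
proof -
  from non_ladder have "decompose T \<noteq> None" by (simp add: decompose_eq_None_iff)
  then obtain B na Fa nb Fb F where d: "decompose T = Some (B, na, Fa, nb, Fb, F)" by auto
  with decompose_SomeD[OF d] that show ?thesis by blast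
qed

lemma num_vertices_tree_merge: "num_vertices (tree_merge T) < num_vertices T"
proof -
  obtain n ns na Fa nb Fb F where "decompose T = Some (trunk n ns, na, Fa, nb, Fb, F)"
    "T = trunk n ns (Node na Fa # Node nb Fb # F)" by (rule decomposition)
  then show ?thesis by (simp add: tree_merge_def num_vertices_trunk)
qed

lemma num_vertices_tree_ab: "num_vertices (tree_ab T) = num_vertices T"
proof -
  obtain n ns na Fa nb Fb F where "decompose T = Some (trunk n ns, na, Fa, nb, Fb, F)"
    "T = trunk n ns (Node na Fa # Node nb Fb # F)" by (rule decomposition)
  then show ?thesis by (simp add: tree_ab_def num_vertices_trunk)
qed

lemma num_vertices_tree_ba: "num_vertices (tree_ba T) = num_vertices T"
proof -
  obtain n ns na Fa nb Fb F where "decompose T = Some (trunk n ns, na, Fa, nb, Fb, F)"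
    "T = trunk n ns (Node na Fa # Node nb Fb # F)" by (rule decomposition)
  then show ?thesis by (simp add: tree_ba_def num_vertices_trunk)
qed

lemma subtree_sizes_tree_ab: "subtree_sizes T < subtree_sizes (tree_ab T)"
proof -
  obtain n ns na Fa nb Fb F where d: "decompose T = Some (trunk n ns, na, Fa, nb, Fb, F)"
    and T: "T = trunk n ns (Node na Fa # Node nb Fb # F)" by (rule decomposition)
  have "subtree_sizes T < subtree_sizes (trunk n ns (Node na (Node nb Fb # Fa) # F))"
    unfolding T by (rule subtree_sizes_trunk_mono) auto
  with d show ?thesis by (simp add: tree_ab_def)
qed

lemma subtree_sizes_tree_ba: "subtree_sizes T < subtree_sizes (tree_ba T)"
proof -
  obtain n ns na Fa nb Fb F where d: "decompose T = Some (trunk n ns, na, Fa, nb, Fb, F)"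
    and T: "T = trunk n ns (Node na Fa # Node nb Fb # F)" by (rule decomposition)
  have "subtree_sizes T < subtree_sizes (trunk n ns (Node nb (Node na Fa # Fb) # F))"
    unfolding T by (rule subtree_sizes_trunk_mono) auto
  with d show ?thesis by (simp add: tree_ba_def)
qed

end

function process_tree :: "PT \<Rightarrow> PT ptree" where
  "process_tree T =
     (if is_ladder T then Node T []
      else Node T [process_tree (tree_merge T), process_tree (tree_ab T), process_tree (tree_ba T)])"
  by pat_completeness auto
termination
proof (relation "measures [num_vertices, \<lambda>T. (num_vertices T)\<^sup>2 - subtree_sizes T]", goal_cases)
  case 1
  show ?case by simp
next
  case (2 T)
  then show ?case by (simp add: num_vertices_tree_merge)
next
  case (3 T)
  then show ?case
    using subtree_sizes_tree_ab[of T] subtree_sizes_le[of "tree_ab T"]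
    by (simp add: num_vertices_tree_ab)
next
  case (4 T)
  then show ?case
    using subtree_sizes_tree_ba[of T] subtree_sizes_le[of "tree_ba T"]
    by (simp add: num_vertices_tree_ba)
qed

declare process_tree.simps [simp del]

section \<open>The error term and the linear map\<close>

type_synonym 'k PT_space = "PT \<Rightarrow>\<^sub>0 'k"

definition scale :: "'k :: field \<Rightarrow> 'k PT_space \<Rightarrow> 'k PT_space" where
  "scale c = Poly_Mapping.map ((*) c)"

definition basis :: "PT \<Rightarrow> 'k :: field PT_space" where
  "basis T = Poly_Mapping.single T 1"

text \<open>
  All subtractions on \<open>nat\<close> below are exact, and all arguments of \<open>pos_of_nat\<close> are positive.
\<close>

definition error_term :: "PT \<Rightarrow> 'k :: field PT_space" where
  "error_term T = (case decompose T of None \<Rightarrow> 0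
     | Some (B, na, Fa, nb, Fb, F) \<Rightarrow>
        (let a = nat_of_pos na; b = nat_of_pos nb in
         basis (tree_merge T)
         - (\<Sum>i = 1..a - 1. scale (of_nat ((a - i + b - 1) choose (b - 1)))
              (basis (B (Node (pos_of_nat (a + b - i)) (Node (pos_of_nat i) Fa # Fb) # F))))
         - (\<Sum>i = 1..b - 1. scale (of_nat ((b - i + a - 1) choose (a - 1)))
              (basis (B (Node (pos_of_nat (a + b - i)) (Node (pos_of_nat i) Fb # Fa) # F))))))"

definition phi_tree :: "PT \<Rightarrow> 'k :: field PT_space" where
  "phi_tree T = basis T +
     (\<Sum>v\<in>vertices (process_tree T). error_term (decoration (process_tree T) v))"

definition phi :: "'k :: field PT_space \<Rightarrow> 'k PT_space" where
  "phi x = (\<Sum>T\<in>Poly_Mapping.keys x. scale (Poly_Mapping.lookup x T) (phi_tree T))"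

lemma lookup_scale [simp]: "Poly_Mapping.lookup (scale c x) T = c * Poly_Mapping.lookup x T"
  by (simp add: scale_def map.rep_eq when_def)

lemma vector_space_scale: "vector_space (scale :: 'k :: field \<Rightarrow> _)"
  by unfold_locales (auto intro!: poly_mapping_eqI simp: lookup_add algebra_simps)

lemma linear_phi: "Vector_Spaces.linear scale scale (phi :: 'k :: field PT_space \<Rightarrow> _)"
proof -
  interpret vector_space "scale :: 'k \<Rightarrow> 'k PT_space \<Rightarrow> 'k PT_space"
    by (rule vector_space_scale)
  have phi_superset: "phi x = (\<Sum>T\<in>A. scale (Poly_Mapping.lookup x T) (phi_tree T))"
    if "finite A" "Poly_Mapping.keys x \<subseteq> A" for x :: "'k PT_space" and A
    unfolding phi_def using that
    by (intro sum.mono_neutral_left) (auto simp: in_keys_iff)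
  show ?thesis
  proof unfold_locales
    fix x y :: "'k PT_space"
    let ?A = "Poly_Mapping.keys x \<union> Poly_Mapping.keys y"
    have "Poly_Mapping.keys (x + y) \<subseteq> ?A" by (rule keys_add)
    then show "phi (x + y) = phi x + phi y"
      by (simp add: phi_superset[of ?A] lookup_add scale_left_distrib sum.distrib)
  next
    fix c :: 'k and x :: "'k PT_space"
    have "Poly_Mapping.keys (scale c x) \<subseteq> Poly_Mapping.keys x" by (auto simp: in_keys_iff)
    then show "phi (scale c x) = scale c (phi x)"
      by (simp add: phi_superset[of "Poly_Mapping.keys x"] scale_sum_right)
  qed
qed

lemma phi_basis: "phi (basis T) = phi_tree T"
  by (auto simp: phi_def basis_def intro!: poly_mapping_eqI)

end

(* The map phi is unitriangular: every tree occurring in phi(T) - T has fewer vertices than T, or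
   as many vertices but a larger sum of the sizes of its rooted subtrees. Since a tree with n
   vertices has subtree size sum at most n^2, the number n^3 - (subtree size sum) is a single
   natural-number rank that drops in both cases. *)
theory Submission
  imports Defs
begin

definition rank :: "'a ptree \<Rightarrow> nat" where
  "rank T = num_vertices T ^ 3 - subtree_sizes T"

lemma subtree_sizes_pos: "0 < subtree_sizes t"
  by (cases t) simp

text \<open>The ranks of trees with n vertices lie between n^3 - n^2 and n^3 - 1. Since (n-1)^3
  \<le> n^3 - n^2, these intervals are disjoint and increase with n; this is what the cube
  buys.\<close>

lemma rank_less_if_num_vertices_less:
  assumes "num_vertices S < num_vertices T"
  shows "rank S < rank T"
proof -
  define m where "m = num_vertices T - 1"
  have T: "num_vertices T = Suc m" and S: "num_vertices S \<le> m"
    using assms by (auto simp: m_def)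
  have "0 < m" using S num_vertices_pos[of S] by simp
  have "rank S < num_vertices S ^ 3"
    using num_vertices_pos[of S] subtree_sizes_pos[of S] by (simp add: rank_def)
  also have "\<dots> \<le> m ^ 3" using S by (rule power_mono) simp
  also have "\<dots> \<le> Suc m ^ 3 - (Suc m)\<^sup>2"
    by (simp add: power2_eq_square power3_eq_cube algebra_simps)
  also have "\<dots> \<le> rank T"
    using subtree_sizes_le[of T] unfolding rank_def T by (rule diff_le_mono2)
  finally show ?thesis .
qed

lemma rank_less_if_subtree_sizes_greater:
  assumes "num_vertices S = num_vertices T" and "subtree_sizes T < subtree_sizes S"
  shows "rank S < rank T"
proof -
  \<comment> \<open>This keeps the subtraction on \<open>nat\<close> from truncating, so a larger
    subtrahend gives a strictly smaller rank.\<close>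
  have "(num_vertices T)\<^sup>2 \<le> num_vertices T ^ 3"
    using num_vertices_pos[of T] by (intro power_increasing) auto
  with subtree_sizes_le[of S] assms show ?thesis by (simp add: rank_def)
qed

text \<open>Hanging one sibling below the other keeps the vertex count and enlarges only the subtree
  at the new parent. Rank ignores decorations, so \<open>m\<close> and \<open>k\<close> are free and
  every tree in the binomial sums of \<open>error_term\<close> is covered.\<close>

lemma rank_nest_less:
  "rank (trunk n ns (Node m (Node k Fa # Fb) # F)) < rank (trunk n ns (Node na Fa # Node nb Fb # F))"
  "rank (trunk n ns (Node m (Node k Fb # Fa) # F)) < rank (trunk n ns (Node na Fa # Node nb Fb # F))"
  by (intro rank_less_if_subtree_sizes_greater subtree_sizes_trunk_mono;
      simp add: num_vertices_trunk)+

text \<open>Only an inclusion, because \<open>c\<close> may be zero, as binomial coefficients can be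
  in positive characteristic.\<close>

lemma keys_scale_basis: "Poly_Mapping.keys (scale c (basis T)) \<subseteq> {T}"
  by (auto simp: in_keys_iff basis_def lookup_single when_def split: if_splits)

lemma keys_minus: "Poly_Mapping.keys (x - y :: 'a \<Rightarrow>\<^sub>0 'b::cancel_comm_monoid_add)
    \<subseteq> Poly_Mapping.keys x \<union> Poly_Mapping.keys y"
  by (auto simp: in_keys_iff lookup_minus)

lemma keys_error_term:
  assumes "S \<in> Poly_Mapping.keys (error_term T :: 'k :: field PT_space)"
  shows "rank S < rank T"
proof (cases "decompose T")
  case None
  with assms show ?thesis by (simp add: error_term_def)
next
  case (Some D)
  obtain B na Fa nb Fb F where D: "D = (B, na, Fa, nb, Fb, F)" by (cases D)
  with Some have d: "decompose T = Some (B, na, Fa, nb, Fb, F)" by simp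
  from decompose_SomeD[OF d] obtain n ns where
    T: "T = trunk n ns (Node na Fa # Node nb Fb # F)" and B: "B = trunk n ns" by blast
  have "\<not> is_ladder T" using d by (simp flip: decompose_eq_None_iff)
  then have merge: "rank (tree_merge T) < rank T"
    by (intro rank_less_if_num_vertices_less num_vertices_tree_merge)
  let ?L = "{S. rank S < rank T}"
  \<comment> \<open>The bound may be asked for every \<open>i\<close>, not only for those in
    \<open>A\<close>, since it holds whatever the decorations are.\<close>
  have sum_L: "Poly_Mapping.keys (\<Sum>i\<in>A. scale (c i) (basis (G i)) :: 'k PT_space) \<subseteq> ?L"
    if "\<And>i. rank (G i) < rank T" for A :: "nat set" and c G
    using keys_sum[of "\<lambda>i. scale (c i) (basis (G i)) :: 'k PT_space" A] keys_scale_basis that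
    by fastforce
  have "Poly_Mapping.keys (error_term T :: 'k PT_space) \<subseteq> ?L"
    unfolding error_term_def d option.case prod.case Let_def B
    by (intro subset_trans[OF keys_minus] Un_least sum_L)
      (use merge in \<open>simp add: basis_def\<close>, simp_all only: T rank_nest_less)
  with assms show ?thesis by auto
qed

text \<open>Each edge of the process tree merges or nests two siblings, so rank drops strictly from
  parent to child and is largest at the root.\<close>

lemma decoration_process_tree:
  "v \<in> vertices (process_tree T) \<Longrightarrow> rank (decoration (process_tree T) v) \<le> rank T"
proof (induction T arbitrary: v rule: process_tree.induct)
  case (1 T)
  show ?case
  proof (cases "is_ladder T")
    case True
    with "1.prems" show ?thesis by (simp add: process_tree.simps[of T])
  next
    case False
    have less: "rank (tree_merge T) < rank T" "rank (tree_ab T) < rank T" "rank (tree_ba T) < rank T"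
      using False rank_less_if_num_vertices_less rank_less_if_subtree_sizes_greater
        num_vertices_tree_merge num_vertices_tree_ab num_vertices_tree_ba
        subtree_sizes_tree_ab subtree_sizes_tree_ba by blast+
    show ?thesis
    proof (cases v)
      case Nil
      with False show ?thesis by (simp add: process_tree.simps[of T])
    next
      case (Cons i w)
      \<comment> \<open>Listing the three successors lets the index \<open>i\<close> of the address
        select the branch uniformly.\<close>
      let ?ts = "[tree_merge T, tree_ab T, tree_ba T]"
      have P: "process_tree T = Node T (map process_tree ?ts)"
        using False by (simp add: process_tree.simps[of T])
      from "1.prems" Cons have i: "i < length ?ts" and w: "w \<in> vertices (process_tree (?ts ! i))"
        unfolding P by (auto simp: less_Suc_eq)
      have "decoration (process_tree T) v = decoration (process_tree (?ts ! i)) w"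
        unfolding P Cons using i by (auto simp: less_Suc_eq)
      moreover have "rank (decoration (process_tree (?ts ! i)) w) \<le> rank (?ts ! i)"
        using 1(1-3)[OF False] i w by (auto simp: less_Suc_eq)
      moreover have "rank (?ts ! i) < rank T"
        using i less by (auto simp: less_Suc_eq)
      ultimately show ?thesis by simp
    qed
  qed
qed

lemma keys_phi_tree_minus_basis:
  assumes "S \<in> Poly_Mapping.keys (phi_tree T - basis T :: 'k :: field PT_space)"
  shows "rank S < rank T"
proof -
  from assms have "S \<in> Poly_Mapping.keys
      (\<Sum>v\<in>vertices (process_tree T). error_term (decoration (process_tree T) v) :: 'k PT_space)"
    by (simp add: phi_tree_def)
  then obtain v where "v \<in> vertices (process_tree T)"
    "S \<in> Poly_Mapping.keys (error_term (decoration (process_tree T) v) :: 'k PT_space)"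
    using keys_sum by fast
  then show ?thesis using keys_error_term decoration_process_tree by (meson less_le_trans)
qed

text \<open>Unitriangularity in coordinates: the correction to \<open>basis S\<close> has rank
  strictly below \<open>S\<close>, so it cannot reach \<open>T\<close>, even when \<open>T\<close>
  is a different tree of equal rank.\<close>

lemma lookup_phi_tree:
  assumes "rank S \<le> rank T"
  shows "Poly_Mapping.lookup (phi_tree S :: 'k :: field PT_space) T = (if S = T then 1 else 0)"
proof -
  have "T \<notin> Poly_Mapping.keys (phi_tree S - basis S :: 'k PT_space)"
    using keys_phi_tree_minus_basis[of T S] assms by fastforce
  then show ?thesis by (auto simp: in_keys_iff lookup_minus basis_def lookup_single when_def)
qed

lemma sum_scale_basis:
  "(\<Sum>T\<in>Poly_Mapping.keys x. scale (Poly_Mapping.lookup x T) (basis T)) = (x :: 'k :: field PT_space)"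
proof (rule poly_mapping_eqI)
  fix S
  have "Poly_Mapping.lookup x T * (Poly_Mapping.lookup (basis T) S)
      = (if T = S then Poly_Mapping.lookup x T else 0)" for T
    by (simp add: basis_def lookup_single)
  then show "Poly_Mapping.lookup
      (\<Sum>T\<in>Poly_Mapping.keys x. scale (Poly_Mapping.lookup x T) (basis T)) S = Poly_Mapping.lookup x S"
    by (simp add: lookup_sum in_keys_iff)
qed

text \<open>At a tree of maximal rank in the support of \<open>x\<close>, the coefficients of
  \<open>phi x\<close> and \<open>x\<close> agree, so a nonzero \<open>x\<close> has a nonzero
  image.\<close>

lemma phi_eq_0D:
  assumes "phi x = (0 :: 'k :: field PT_space)"
  shows "x = 0"
proof (rule ccontr)
  assume "x \<noteq> 0"
  then have K: "finite (Poly_Mapping.keys x)" "Poly_Mapping.keys x \<noteq> {}" by auto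
  then have "Max (rank ` Poly_Mapping.keys x) \<in> rank ` Poly_Mapping.keys x" by (intro Max_in) auto
  then obtain T where T: "T \<in> Poly_Mapping.keys x"
    and "rank T = Max (rank ` Poly_Mapping.keys x)" by auto
  with K(1) have max: "rank S \<le> rank T" if "S \<in> Poly_Mapping.keys x" for S
    using that by simp
  have "Poly_Mapping.lookup (phi x) T
      = (\<Sum>S\<in>Poly_Mapping.keys x. if S = T then Poly_Mapping.lookup x S else 0)"
    unfolding phi_def lookup_sum by (rule sum.cong) (simp_all add: lookup_phi_tree max)
  also have "\<dots> = Poly_Mapping.lookup x T" using T by simp
  finally show False using T assms by (simp add: in_keys_iff)
qed

theorem proposition49:
  shows "bij (phi :: 'k :: field PT_space \<Rightarrow> 'k PT_space)"
proof -
  interpret Vector_Spaces.linear scale scale "phi :: 'k PT_space \<Rightarrow> 'k PT_space"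
    by (rule linear_phi)
  have range: "vs1.subspace (range phi)" by (rule subspace_image) (rule vs1.subspace_UNIV)
  have sum_in_range: "x \<in> range phi"
    if "\<And>T. T \<in> Poly_Mapping.keys x \<Longrightarrow> (basis T :: 'k PT_space) \<in> range phi"
    for x :: "'k PT_space"
    by (subst sum_scale_basis[of x, symmetric])
      (intro vs1.subspace_sum[OF range] vs1.subspace_scale[OF range] that)
  \<comment> \<open>Write \<open>basis T\<close> as \<open>phi (basis T)\<close> minus the
    correction. The correction is a finite combination of trees of smaller rank, which lie in the
    range by induction.\<close>
  have basis_in_range: "(basis T :: 'k PT_space) \<in> range phi" for T
  proof (induction T rule: measure_induct_rule[of rank])
    case (less T)
    have "phi_tree T - basis T \<in> range (phi :: 'k PT_space \<Rightarrow> _)"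
      by (rule sum_in_range, rule less, rule keys_phi_tree_minus_basis)
    then have "phi (basis T) - (phi_tree T - basis T) \<in> range (phi :: 'k PT_space \<Rightarrow> _)"
      by (rule vs1.subspace_diff[OF range rangeI])
    then show ?case by (simp add: phi_basis)
  qed
  show ?thesis
  proof (rule bijI)
    show "inj (phi :: 'k PT_space \<Rightarrow> _)"
      using phi_eq_0D by (auto simp: inj_iff_eq_0)
    show "surj (phi :: 'k PT_space \<Rightarrow> _)"
      using sum_in_range basis_in_range by blast
  qed
qed

end
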